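(* Let $1\le k\le n$, $s=\lfloor n/k\rfloor+1$ and $t$ the remainder of $n$ upon division by $k$. Then \[H_{n,k}(x)=I(n,k,0)\,A_s(x)^t\,A_{s-1}(x)^{k-t},\] where \[I(n,k,0)=\prod_{j=1}^{k-1}\binom{n-\sum_{i=0}^{j-1}\lambda_i}{\lambda_j},\] with $\lambda_0=0$ and $\lambda_j=\lfloor (n-j)/k\rfloor+1$ for $1\le j\le k$ (the length of the $j$-th $k$-step run).
   Context: $S_n$ is the set of permutations of $\{1,\dots,n\}$. A $k$-step inversion of $\pi$ is a pair $(a,b)$ with $1\le a<b\le n$, $b-a=k$ and $\pi(a)>\pi(b)$; $\operatorname{inv}_k(\pi)$ is their number. $H_{n,k}(x)=\sum_{\pi\in S_n}x^{\operatorname{inv}_k(\pi)}$, and $I(n,k,i)=[x^i]H_{n,k}(x)$ is the number of $\pi\in S_n$ with exactly $i$ $k$-step inversions. For $1\le i\le k$, the $i$-th $k$-step run of $\pi$ is the subsequence $\pi_i,\pi_{i+k},\pi_{i+2k},\dots$ of positions congruent to $i$ mod $k$, of length $\lfloor (n-i)/k\rfloor+1$. $A_\ell(x)=\sum_{\sigma\in S_\ell}x^{\operatorname{des}(\sigma)}$ is the $\ell$-th Eulerian polynomial, where $\operatorname{des}(\sigma)$ is the number of $i$ with $\sigma_i>\sigma_{i+1}$ (so $A_0=A_1=1$). *)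

theory Defs
  imports
    "HOL-Combinatorics.Permutations"
    "HOL-Computational_Algebra.Polynomial"
begin

text \<open>
  \<open>S\<^sub>n\<close> is rendered as \<open>{p. p permutes {1..n}}\<close>: bijections of \<open>nat\<close> that fix every point
  outside \<open>{1..n}\<close>. All generating functions are polynomials with integer coefficients,
  and \<open>monom 1 m\<close> is \<open>x ^ m\<close>.
\<close>

definition kstep_inversions :: "nat \<Rightarrow> nat \<Rightarrow> (nat \<Rightarrow> nat) \<Rightarrow> (nat \<times> nat) set" where
  "kstep_inversions n k p =
     {(a, b). 1 \<le> a \<and> a < b \<and> b \<le> n \<and> b - a = k \<and> p a > p b}"

definition inv_kstep :: "nat \<Rightarrow> nat \<Rightarrow> (nat \<Rightarrow> nat) \<Rightarrow> nat" where
  "inv_kstep n k p = card (kstep_inversions n k p)"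

definition kstep_poly :: "nat \<Rightarrow> nat \<Rightarrow> int poly" where
  "kstep_poly n k = (\<Sum>p | p permutes {1..n}. monom 1 (inv_kstep n k p))"

definition kstep_count :: "nat \<Rightarrow> nat \<Rightarrow> nat \<Rightarrow> nat" where
  "kstep_count n k i = card {p. p permutes {1..n} \<and> inv_kstep n k p = i}"

lemma coeff_kstep_poly: "coeff (kstep_poly n k) i = int (kstep_count n k i)"
proof -
  have "finite {p. p permutes {1..n}}"
    by (simp add: finite_permutations)
  then show ?thesis
    by (simp add: kstep_poly_def kstep_count_def coeff_sum if_distrib sum.If_cases
        Int_def conj_commute)
qed

definition des :: "nat \<Rightarrow> (nat \<Rightarrow> nat) \<Rightarrow> nat" where
  "des l p = card {i \<in> {1..<l}. p i > p (i + 1)}"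

definition eulerian_poly :: "nat \<Rightarrow> int poly" where
  "eulerian_poly l = (\<Sum>p | p permutes {1..l}. monom 1 (des l p))"

end

theory Submission
  imports Defs
begin

text \<open>
  A \<open>k\<close>-step inversion is a descent of one of the \<open>k\<close> runs, so \<open>x ^ inv\<^sub>k\<close> is a product of
  factors that each see only one run. A permutation amounts to a distribution of the values
  among the runs together with an arrangement of the values inside each run. Up to an order
  isomorphism of the value set, summing over the arrangements of a run of length \<open>l\<close> gives
  the Eulerian polynomial \<open>A\<^sub>l\<close>, whichever values the run received, so the number of
  distributions factors out. The constant coefficient of \<open>A\<^sub>l\<close> is 1, which identifies that
  number with \<open>I(n, k, 0)\<close>.
\<close>

section \<open>Sums over bijections of finite sets\<close>

text \<open>Extensionality fixes the values off \<open>S\<close>, so that each bijection from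
  \<open>S\<close> onto \<open>V\<close> is represented by exactly one function and sums over them
  count correctly.\<close>

definition bijections :: "'a set \<Rightarrow> 'b set \<Rightarrow> ('a \<Rightarrow> 'b) set" where
  "bijections S V = {f \<in> extensional S. bij_betw f S V}"

lemma finite_bijections:
  assumes "finite S" "finite V"
  shows "finite (bijections S V)"
proof (rule finite_subset)
  show "bijections S V \<subseteq> S \<rightarrow>\<^sub>E V"
    by (auto simp: bijections_def PiE_def bij_betw_def)
  show "finite (S \<rightarrow>\<^sub>E V)"
    using assms by (rule finite_PiE)
qed

text \<open>A bijection on a disjoint union amounts to the image \<open>W\<close> of
  \<open>S\<close>, a bijection \<open>S\<close> to \<open>W\<close> and a bijection
  \<open>T\<close> to \<open>V - W\<close>. The hypotheses on \<open>g\<close> and \<open>h\<close>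
  say that each weight sees only its own block, so the weight of the glued function factors.\<close>

lemma sum_bijections_Un:
  fixes g h :: "('a \<Rightarrow> 'b) \<Rightarrow> 'c::comm_semiring_1"
  assumes fin: "finite S" "finite T" "finite V" and disj: "S \<inter> T = {}"
    and g: "\<And>f f'. (\<And>x. x \<in> S \<Longrightarrow> f x = f' x) \<Longrightarrow> g f = g f'"
    and h: "\<And>f f'. (\<And>x. x \<in> T \<Longrightarrow> f x = f' x) \<Longrightarrow> h f = h f'"
  shows "(\<Sum>f\<in>bijections (S \<union> T) V. g f * h f) =
    (\<Sum>W | W \<subseteq> V \<and> card W = card S.
      (\<Sum>f\<in>bijections S W. g f) * (\<Sum>f\<in>bijections T (V - W). h f))"
proof -
  let ?\<W> = "{W. W \<subseteq> V \<and> card W = card S}"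
  let ?P = "\<lambda>W. bijections S W \<times> bijections T (V - W)"
  \<comment> \<open>Inverse of splitting \<open>f\<close> into its two restrictions; the outer
    \<open>restrict\<close> makes the glued function extensional again.\<close>
  let ?glue = "\<lambda>a b. restrict (\<lambda>x. if x \<in> S then a x else b x) (S \<union> T)"
  have "(\<Sum>f\<in>bijections (S \<union> T) V. g f * h f) =
    (\<Sum>(W, a, b)\<in>Sigma ?\<W> ?P. g a * h b)"
  proof (rule sum.reindex_bij_witness
      [where j = "\<lambda>f. (f ` S, restrict f S, restrict f T)" and i = "\<lambda>(W, a, b). ?glue a b"])
    fix f assume f: "f \<in> bijections (S \<union> T) V"
    then have ext: "f \<in> extensional (S \<union> T)" and inj: "inj_on f (S \<union> T)"
      and img: "f ` (S \<union> T) = V"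
      by (auto simp: bijections_def bij_betw_def)
    show "(case (f ` S, restrict f S, restrict f T) of (W, a, b) \<Rightarrow> ?glue a b) = f"
      using ext by (auto simp: fun_eq_iff extensional_def)
    have "inj_on f S" "inj_on f T"
      using inj by (auto simp: inj_on_Un)
    moreover have "f ` T = V - f ` S"
      using inj img disj by (auto simp: inj_on_def)
    ultimately show "(f ` S, restrict f S, restrict f T) \<in> Sigma ?\<W> ?P"
      using img by (auto simp: bijections_def bij_betw_def card_image inj_on_def)
    show "(case (f ` S, restrict f S, restrict f T) of (W, a, b) \<Rightarrow> g a * h b) = g f * h f"
      using g[of "restrict f S" f] h[of "restrict f T" f] by simp
  next
    fix w assume w: "w \<in> Sigma ?\<W> ?P"
    obtain W a b where [simp]: "w = (W, a, b)"
      by (cases w)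
    have W: "W \<subseteq> V" and a: "a \<in> extensional S" "inj_on a S" "a ` S = W"
      and b: "b \<in> extensional T" "inj_on b T" "b ` T = V - W"
      using w by (auto simp: bijections_def bij_betw_def)
    have S: "?glue a b x = a x" if "x \<in> S" for x
      using that by simp
    have T: "?glue a b x = b x" if "x \<in> T" for x
      using that disj by auto
    have img: "?glue a b ` S = W" "?glue a b ` T = V - W"
      using S T a b by (simp_all cong: image_cong_simp)
    have inj: "inj_on (?glue a b) S" "inj_on (?glue a b) T"
      using S T a(2) b(2) by (simp_all cong: inj_on_cong)
    have "bij_betw (?glue a b) (S \<union> T) (W \<union> (V - W))"
      by (rule bij_betw_combine) (use inj img in \<open>auto simp: bij_betw_def\<close>)
    then show "(case w of (W, a, b) \<Rightarrow> ?glue a b) \<in> bijections (S \<union> T) V"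
      using W by (simp add: bijections_def Un_absorb1)
    have "restrict (?glue a b) S = a" "restrict (?glue a b) T = b"
      using a(1) b(1) disj by (auto simp: fun_eq_iff extensional_def)
    then show "((case w of (W, a, b) \<Rightarrow> ?glue a b) ` S,
        restrict (case w of (W, a, b) \<Rightarrow> ?glue a b) S,
        restrict (case w of (W, a, b) \<Rightarrow> ?glue a b) T) = w"
      using img by simp
  qed
  also have "\<dots> = (\<Sum>W\<in>?\<W>. \<Sum>(a, b)\<in>?P W. g a * h b)"
  proof (rule sum.Sigma[symmetric])
    show "finite ?\<W>"
      using fin by simp
    show "\<forall>W\<in>?\<W>. finite (?P W)"
      using fin by (auto intro!: finite_bijections finite_cartesian_product intro: finite_subset)
  qed
  also have "\<dots> = (\<Sum>W\<in>?\<W>. (\<Sum>f\<in>bijections S W. g f) * (\<Sum>f\<in>bijections T (V - W). h f))"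
    by (simp add: sum_product sum.cartesian_product)
  finally show ?thesis .
qed

text \<open>The blocks are peeled off one at a time. The hypothesis \<open>total\<close> makes the
  contribution of a block independent of the values it receives, so each block yields
  \<open>a j\<close> times the number of ways to choose its values. The tail sum in the binomial
  counts the values still available when block \<open>j\<close> chooses.\<close>

lemma sum_bijections_UN:
  fixes w :: "nat \<Rightarrow> ('a \<Rightarrow> 'b) \<Rightarrow> 'c::comm_semiring_1"
  assumes fin: "\<And>j. finite (S j)"
    and disj: "\<And>i j. i \<noteq> j \<Longrightarrow> S i \<inter> S j = {}"
    and local: "\<And>j f f'. (\<And>x. x \<in> S j \<Longrightarrow> f x = f' x) \<Longrightarrow> w j f = w j f'"
    and total: "\<And>j W. finite W \<Longrightarrow> card W = card (S j) \<Longrightarrow> (\<Sum>f\<in>bijections (S j) W. w j f) = a j"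
    and "m \<le> Suc k" "finite V" "card V = (\<Sum>i=m..k. card (S i))"
  shows "(\<Sum>f\<in>bijections (\<Union>j\<in>{m..k}. S j) V. \<Prod>j=m..k. w j f) =
    (\<Prod>j=m..k. of_nat ((\<Sum>i=j..k. card (S i)) choose card (S j)) * a j)"
  using assms(5-)
\<comment> \<open>The induction descends from \<open>Suc k\<close>, where no block is left.
  \<open>V\<close> stays arbitrary because the remaining values depend on the earlier choice
  \<open>W\<close>.\<close>
proof (induction m arbitrary: V rule: inc_induct)
  case base
  then have "V = {}"
    by simp
  \<comment> \<open>The empty domain admits one extensional function, and its weight is the empty
    product 1.\<close>
  then have "bijections ({} :: 'a set) V = {\<lambda>x. undefined}"
    by (auto simp: bijections_def bij_betw_def)
  then show ?case
    by simp
next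
  case (step m)
  let ?T = "\<Union>j\<in>{Suc m..k}. S j" and ?N = "\<lambda>j. \<Sum>i=j..k. card (S i)"
  let ?c = "\<Prod>j=Suc m..k. of_nat (?N j choose card (S j)) * a j"
  have m: "{m..k} = insert m {Suc m..k}"
    using step.hyps by auto
  have "(\<Sum>f\<in>bijections (\<Union>j\<in>{m..k}. S j) V. \<Prod>j=m..k. w j f) =
    (\<Sum>f\<in>bijections (S m \<union> ?T) V. w m f * (\<Prod>j=Suc m..k. w j f))"
    by (simp add: m)
  also have "\<dots> = (\<Sum>W | W \<subseteq> V \<and> card W = card (S m).
      (\<Sum>f\<in>bijections (S m) W. w m f) *
      (\<Sum>f\<in>bijections ?T (V - W). \<Prod>j=Suc m..k. w j f))"
  proof (rule sum_bijections_Un)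
    have "S m \<inter> S j = {}" if "j \<in> {Suc m..k}" for j
      using that by (intro disj) auto
    then show "S m \<inter> ?T = {}"
      by blast
    show "w m f = w m f'" if "\<And>x. x \<in> S m \<Longrightarrow> f x = f' x" for f f'
      using that by (rule local)
    show "(\<Prod>j=Suc m..k. w j f) = (\<Prod>j=Suc m..k. w j f')" if "\<And>x. x \<in> ?T \<Longrightarrow> f x = f' x" for f f'
      by (intro prod.cong[OF refl] local that) blast
  qed (use fin step.prems in auto)
  \<comment> \<open>The summand loses its dependence on \<open>W\<close>; afterwards only the number
    of subsets \<open>W\<close> matters.\<close>
  also have "\<dots> = (\<Sum>W | W \<subseteq> V \<and> card W = card (S m). a m * ?c)"
  proof (rule sum.cong[OF refl])
    fix W assume "W \<in> {W. W \<subseteq> V \<and> card W = card (S m)}"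
    then have W: "W \<subseteq> V" "card W = card (S m)" "finite W"
      using step.prems finite_subset by auto
    have "card (V - W) = ?N (Suc m)"
      using W step.prems by (simp add: card_Diff_subset m)
    then show "(\<Sum>f\<in>bijections (S m) W. w m f) *
        (\<Sum>f\<in>bijections ?T (V - W). \<Prod>j=Suc m..k. w j f) = a m * ?c"
      using W step.prems total step.IH[of "V - W"] by simp
  qed
  also have "\<dots> = of_nat (?N m choose card (S m)) * (a m * ?c)"
    using step.prems by (simp add: n_subsets)
  finally show ?case
    by (simp add: m mult.assoc)
qed

section \<open>Transport to permutations and Eulerian polynomials\<close>

text \<open>With \<open>e\<close> numbering the positions and \<open>u\<close> the values,
  \<open>p\<close> corresponds to \<open>u\<close> after \<open>p\<close> after the inverse of
  \<open>e\<close>. The assumption on \<open>g\<close> and \<open>h\<close> is phrased through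
  \<open>f (e i) = u (p i)\<close>, so applications never meet the inverse functions.\<close>

lemma sum_permutes_eq_sum_bijections:
  fixes e :: "nat \<Rightarrow> 'a" and u :: "nat \<Rightarrow> 'b"
  assumes e: "bij_betw e {1..l} S" and u: "bij_betw u {1..l} V"
    and g: "\<And>p f. p permutes {1..l} \<Longrightarrow> (\<And>i. i \<in> {1..l} \<Longrightarrow> f (e i) = u (p i)) \<Longrightarrow> g f = h p"
  shows "(\<Sum>f\<in>bijections S V. g f) = (\<Sum>p | p permutes {1..l}. h p)"
proof (rule sym, rule sum.reindex_bij_witness
    \<comment> \<open>The backward map conjugates by the inverse enumerations and is completed by
      the identity outside \<open>{1..l}\<close>, as \<open>permutes\<close> demands.\<close>
    [where j = "\<lambda>p. restrict (\<lambda>x. u (p (inv_into {1..l} e x))) S" and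
      i = "\<lambda>f i. if i \<in> {1..l} then inv_into {1..l} u (f (e i)) else i"])
  let ?e' = "inv_into {1..l} e" and ?u' = "inv_into {1..l} u"
  have e': "bij_betw ?e' S {1..l}" and u': "bij_betw ?u' V {1..l}"
    using e u by (simp_all add: bij_betw_inv_into)
  have ee': "\<And>x. x \<in> S \<Longrightarrow> e (?e' x) = x" and e'e: "\<And>i. i \<in> {1..l} \<Longrightarrow> ?e' (e i) = i"
    and uu': "\<And>x. x \<in> V \<Longrightarrow> u (?u' x) = x" and u'u: "\<And>i. i \<in> {1..l} \<Longrightarrow> ?u' (u i) = i"
    using e u by (simp_all add: bij_betw_inv_into_left bij_betw_inv_into_right)
  have eS: "\<And>i. i \<in> {1..l} \<Longrightarrow> e i \<in> S" and e'S: "\<And>x. x \<in> S \<Longrightarrow> ?e' x \<in> {1..l}"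
    using e e' by (meson bij_betwE)+
  {
    fix p assume p: "p \<in> {p. p permutes {1..l}}"
    then have pp: "p permutes {1..l}"
      by simp
    have pS: "\<And>i. i \<in> {1..l} \<Longrightarrow> p i \<in> {1..l}"
      using permutes_in_image[OF pp] by simp
    show "(\<lambda>i. if i \<in> {1..l} then ?u' (restrict (\<lambda>x. u (p (?e' x))) S (e i)) else i) = p"
    proof
      fix i show "(if i \<in> {1..l} then ?u' (restrict (\<lambda>x. u (p (?e' x))) S (e i)) else i) = p i"
        using eS[of i] e'e[of i] u'u[OF pS, of i] permutes_not_in[OF pp, of i] by (auto simp del: atLeastAtMost_iff)
    qed
    have "bij_betw (u \<circ> (p \<circ> ?e')) S V"
      using e' permutes_imp_bij[OF pp] u by (blast intro: bij_betw_trans)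
    then show "restrict (\<lambda>x. u (p (?e' x))) S \<in> bijections S V"
      by (simp add: bijections_def o_def)
    show "g (restrict (\<lambda>x. u (p (?e' x))) S) = h p"
      by (rule g[OF pp]) (simp add: eS e'e del: atLeastAtMost_iff One_nat_def)
  next
    fix f assume "f \<in> bijections S V"
    then have f: "f \<in> extensional S" and bij: "bij_betw f S V"
      by (auto simp: bijections_def)
    have "bij_betw (?u' \<circ> (f \<circ> e)) {1..l} {1..l}"
      using e bij u' by (blast intro: bij_betw_trans)
    then have "bij_betw (\<lambda>i. if i \<in> {1..l} then ?u' (f (e i)) else i) {1..l} {1..l}"
      by (simp add: o_def cong: bij_betw_cong del: atLeastAtMost_iff One_nat_def)
    then show "(\<lambda>i. if i \<in> {1..l} then ?u' (f (e i)) else i) \<in> {p. p permutes {1..l}}"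
      by (simp add: bij_imp_permutes del: atLeastAtMost_iff)
    show "restrict (\<lambda>x. u (if ?e' x \<in> {1..l} then ?u' (f (e (?e' x))) else ?e' x)) S = f"
    proof
      fix x show "restrict (\<lambda>x. u (if ?e' x \<in> {1..l} then ?u' (f (e (?e' x))) else ?e' x)) S x = f x"
      proof (cases "x \<in> S")
        case True
        then show ?thesis
          using e'S[OF True] ee'[OF True] uu' bij_betwE[OF bij] by simp
      next
        case False
        then show ?thesis
          using f by (simp add: extensional_def)
      qed
    qed
  }
qed

text \<open>Numbering the values of \<open>V\<close> increasingly preserves all comparisons, hence
  descents, so only the size of \<open>V\<close> matters. Positions are read in the order given by
  \<open>e\<close>. This supplies the hypothesis \<open>total\<close> of
  \<open>sum_bijections_UN\<close>.\<close>

lemma sum_bijections_des: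
  fixes V :: "nat set"
  assumes e: "bij_betw e {1..l} S" and V: "finite V" "card V = l"
  shows "(\<Sum>f\<in>bijections S V. monom 1 (des l (\<lambda>i. f (e i)))) = eulerian_poly l"
proof -
  \<comment> \<open>The increasing enumeration of \<open>V\<close>; \<open>i - 1\<close> converts
    indices from 1 into list indices from 0.\<close>
  define u where "u i = sorted_list_of_set V ! (i - 1)" for i
  have less: "u i < u j \<longleftrightarrow> i < j" if "i \<in> {1..l}" "j \<in> {1..l}" for i j
  proof -
    have *: "u i < u j" if "i < j" "i \<in> {1..l}" "j \<in> {1..l}" for i j
      using that V sorted_wrt_nth_less[OF strict_sorted_list_of_set[of V], of "i - 1" "j - 1"]
      by (auto simp: u_def)
    show ?thesis
      using that *[of i j] *[of j i] by (cases i j rule: linorder_cases) auto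
  qed
  have inj: "inj_on u {1..l}"
    by (rule inj_onI) (metis less less_irrefl linorder_neqE_nat)
  have "u ` {1..l} \<subseteq> V"
  proof safe
    fix i assume "i \<in> {1..l}"
    then have "u i \<in> set (sorted_list_of_set V)"
      using V unfolding u_def by (intro nth_mem) auto
    then show "u i \<in> V"
      using V by simp
  qed
  then have "u ` {1..l} = V"
    using inj V by (intro card_subset_eq) (auto simp: card_image)
  with inj have u: "bij_betw u {1..l} V"
    by (simp add: bij_betw_def)
  show ?thesis
    unfolding eulerian_poly_def
  proof (rule sum_permutes_eq_sum_bijections[OF e u])
    fix p f assume p: "p permutes {1..l}" and f: "\<And>i. i \<in> {1..l} \<Longrightarrow> f (e i) = u (p i)"
    have "f (e i) > f (e (i + 1)) \<longleftrightarrow> p i > p (i + 1)" if "i \<in> {1..<l}" for i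
      using that f[of i] f[of "i + 1"] less[of "p (i + 1)" "p i"]
        permutes_in_image[OF p, of i] permutes_in_image[OF p, of "i + 1"] by simp
    then have "des l (\<lambda>i. f (e i)) = des l p"
      unfolding des_def by (metis (no_types, lifting))
    then show "monom 1 (des l (\<lambda>i. f (e i))) = monom 1 (des l p)"
      by simp
  qed
qed

text \<open>Without descents \<open>p\<close> increases strictly on \<open>{1..l}\<close>, so
  induction gives \<open>i \<le> p i\<close>; a permutation of a finite set of naturals with this
  property is the identity.\<close>

lemma permutes_des_eq_0_iff:
  assumes "p permutes {1..l}"
  shows "des l p = 0 \<longleftrightarrow> p = id"
proof
  assume "des l p = 0"
  then have step: "p i \<le> p (i + 1)" if "i \<in> {1..<l}" for i
    using that by (auto simp: des_def not_less)
  have "i \<le> p i" if "i \<le> l" "1 \<le> i" for i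
    using that(2,1)
  proof (induction i rule: dec_induct)
    case base
    then show ?case
      using permutes_in_image[OF assms, of 1] by simp
  next
    case (step i)
    have "p i \<noteq> p (Suc i)"
      using permutes_inj[OF assms] by (metis injD n_not_Suc_n)
    then show ?case
      using step \<open>\<And>i. i \<in> {1..<l} \<Longrightarrow> p i \<le> p (i + 1)\<close>[of i] by simp
  qed
  then show "p = id"
    using assms by (intro permutes_natset_ge[of p "{1..l}"]) auto
qed (simp add: des_def)

text \<open>Only the identity contributes. This normalization later identifies the number of value
  distributions with \<open>kstep_count n k 0\<close>.\<close>

lemma coeff_0_eulerian_poly: "coeff (eulerian_poly l) 0 = 1"
proof -
  have "coeff (eulerian_poly l) 0 = (\<Sum>p | p permutes {1..l}. if p = id then 1 else 0)"
    by (auto simp: eulerian_poly_def coeff_sum permutes_des_eq_0_iff intro!: sum.cong)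
  also have "\<dots> = 1"
    by (simp add: finite_permutations permutes_id)
  finally show ?thesis .
qed

section \<open>Runs of positions and \<open>k\<close>-step inversions\<close>

text \<open>The position of the \<open>i\<close>-th entry of the \<open>j\<close>-th run, with both
  indices starting at 1.\<close>

definition run_pos :: "nat \<Rightarrow> nat \<Rightarrow> nat \<Rightarrow> nat" where
  "run_pos k j i = j + (i - 1) * k"

text \<open>Shifting by 1 around \<open>mod\<close> takes residues in \<open>{1..k}\<close>, so
  multiples of \<open>k\<close> belong to run \<open>k\<close> rather than to a run 0.\<close>

definition run :: "nat \<Rightarrow> nat \<Rightarrow> nat \<Rightarrow> nat set" where
  "run n k j = {a \<in> {1..n}. (a - 1) mod k + 1 = j}"

text \<open>Quotient and remainder of the shifted position recover the index within the run and the
  run itself; this is the inverse map in the bijections below.\<close>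

lemma run_pos_diff_1_div_mod:
  assumes "j \<in> {1..k}"
  shows "(run_pos k j i - 1) div k = i - 1" and "(run_pos k j i - 1) mod k = j - 1"
proof -
  have pred: "run_pos k j i - 1 = (j - 1) + (i - 1) * k" and "j - 1 < k"
    using assms by (auto simp: run_pos_def)
  then show "(run_pos k j i - 1) div k = i - 1" "(run_pos k j i - 1) mod k = j - 1"
    unfolding pred by auto
qed

lemma bij_betw_run_pos:
  assumes "j \<in> {1..k}" "k \<le> n"
  shows "bij_betw (run_pos k j) {1..(n - j) div k + 1} (run n k j)"
proof (rule bij_betw_byWitness[where f' = "\<lambda>a. (a - 1) div k + 1"])
  \<comment> \<open>Since \<open>j \<le> k \<le> n\<close>, the subtraction \<open>n - j\<close> is
    not truncated, which the equivalence relies on.\<close>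
  have bound: "run_pos k j i \<le> n \<longleftrightarrow> i - 1 \<le> (n - j) div k" for i
    using assms by (auto simp: run_pos_def less_eq_div_iff_mult_less_eq)
  show "\<forall>i\<in>{1..(n - j) div k + 1}. (run_pos k j i - 1) div k + 1 = i"
    using run_pos_diff_1_div_mod(1)[OF assms(1)] by simp
  show inv: "\<forall>a\<in>run n k j. run_pos k j ((a - 1) div k + 1) = a"
  proof
    fix a assume "a \<in> run n k j"
    then show "run_pos k j ((a - 1) div k + 1) = a"
      using div_mult_mod_eq[of "a - 1" k] by (auto simp: run_def run_pos_def)
  qed
  show "run_pos k j ` {1..(n - j) div k + 1} \<subseteq> run n k j"
  proof safe
    fix i assume i: "i \<in> {1..(n - j) div k + 1}"
    have "run_pos k j i \<le> n"
      unfolding bound using i by (simp add: le_diff_conv)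
    moreover have "1 \<le> run_pos k j i"
      using assms by (simp add: run_pos_def)
    ultimately show "run_pos k j i \<in> run n k j"
      using assms run_pos_diff_1_div_mod(2)[OF assms(1)] by (simp add: run_def)
  qed
  show "(\<lambda>a. (a - 1) div k + 1) ` run n k j \<subseteq> {1..(n - j) div k + 1}"
  proof safe
    fix a assume a: "a \<in> run n k j"
    then have "run_pos k j ((a - 1) div k + 1) \<le> n"
      using inv by (simp add: run_def)
    then show "(a - 1) div k + 1 \<in> {1..(n - j) div k + 1}"
      by (simp add: bound)
  qed
qed

lemma Un_runs: "0 < k \<Longrightarrow> (\<Union>j\<in>{1..k}. run n k j) = {1..n}"
  by (auto simp: run_def Suc_le_eq)

text \<open>Two positions at distance \<open>k\<close> are neighbours in one run, so a
  \<open>k\<close>-step inversion is the same as a pair of a run \<open>j\<close> and a descent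
  \<open>i\<close> of that run.\<close>

lemma inv_kstep_eq_sum_des:
  assumes "1 \<le> k" "k \<le> n"
  shows "inv_kstep n k p = (\<Sum>j=1..k. des ((n - j) div k + 1) (\<lambda>i. p (run_pos k j i)))"
proof -
  let ?D = "\<lambda>j. {i \<in> {1..<(n - j) div k + 1}. p (run_pos k j i) > p (run_pos k j (i + 1))}"
  \<comment> \<open>At \<open>i = 0\<close> truncated subtraction would make the two positions
    coincide, hence the condition \<open>1 \<le> i\<close>.\<close>
  have next_pos: "run_pos k j (i + 1) = run_pos k j i + k" if "1 \<le> i" for i j
    using that by (cases i) (auto simp: run_pos_def)
  have pos: "run_pos k j i \<in> run n k j" if "j \<in> {1..k}" "i \<in> {1..(n - j) div k + 1}" for i j
    using bij_betw_run_pos[of j k n] assms that by (meson bij_betwE)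
  have "bij_betw (\<lambda>(j, i). (run_pos k j i, run_pos k j (i + 1)))
    (Sigma {1..k} ?D) (kstep_inversions n k p)"
  proof (rule bij_betw_byWitness
      [where f' = "\<lambda>(a, b). ((a - 1) mod k + 1, (a - 1) div k + 1)"])
    have inv: "(run_pos k j i - 1) mod k + 1 = j" "(run_pos k j i - 1) div k + 1 = i"
      if "j \<in> {1..k}" "i \<in> {1..(n - j) div k + 1}" for i j
      using that run_pos_diff_1_div_mod[OF that(1)] by simp_all
    then show "\<forall>x\<in>Sigma {1..k} ?D. (\<lambda>(a, b). ((a - 1) mod k + 1, (a - 1) div k + 1))
        ((\<lambda>(j, i). (run_pos k j i, run_pos k j (i + 1))) x) = x"
      by auto
    have recover: "run_pos k ((a - 1) mod k + 1) ((a - 1) div k + 1) = a" if "1 \<le> a" for a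
      using that div_mult_mod_eq[of "a - 1" k] by (simp add: run_pos_def)
    show "\<forall>x\<in>kstep_inversions n k p. (\<lambda>(j, i). (run_pos k j i, run_pos k j (i + 1)))
        ((\<lambda>(a, b). ((a - 1) mod k + 1, (a - 1) div k + 1)) x) = x"
      using recover next_pos by (auto simp: kstep_inversions_def)
    show "(\<lambda>(j, i). (run_pos k j i, run_pos k j (i + 1))) ` Sigma {1..k} ?D
        \<subseteq> kstep_inversions n k p"
    proof clarify
      fix j i assume j: "j \<in> {1..k}" and i: "i \<in> {1..<(n - j) div k + 1}"
        and less: "p (run_pos k j (i + 1)) < p (run_pos k j i)"
      then show "(run_pos k j i, run_pos k j (i + 1)) \<in> kstep_inversions n k p"
        using pos[of j "i + 1"] pos[of j i] next_pos[of i j] assms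
        by (simp add: kstep_inversions_def run_def)
    qed
    show "(\<lambda>(a, b). ((a - 1) mod k + 1, (a - 1) div k + 1)) ` kstep_inversions n k p
        \<subseteq> Sigma {1..k} ?D"
    proof (rule image_subsetI)
      fix x assume "x \<in> kstep_inversions n k p"
      then obtain a b where x: "x = (a, b)" and a: "1 \<le> a" and b: "b = a + k" "b \<le> n" and p: "p b < p a"
        by (auto simp: kstep_inversions_def)
      let ?j = "(a - 1) mod k + 1" and ?i = "(a - 1) div k + 1"
      have j: "?j \<in> {1..k}"
        using assms by (simp add: Suc_le_eq)
      have ab: "run_pos k ?j ?i = a" "run_pos k ?j (?i + 1) = b"
        using recover[OF a] next_pos[of ?i ?j] b by simp_all
      \<comment> \<open>The left side is \<open>b\<close>, the entry after \<open>a\<close> in the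
        run. Its being at most \<open>n\<close> keeps \<open>?i\<close> strictly below the run
        length, as a descent index must be.\<close>
      have "?j + ?i * k \<le> n"
        using ab(2) b by (simp add: run_pos_def)
      then have "?i \<le> (n - ?j) div k"
        using assms(1) by (simp only: less_eq_div_iff_mult_less_eq)
      then show "(\<lambda>(a, b). ((a - 1) mod k + 1, (a - 1) div k + 1)) x \<in> Sigma {1..k} ?D"
        using j ab p x by simp
    qed
  qed
  then have "inv_kstep n k p = card (Sigma {1..k} ?D)"
    by (simp add: inv_kstep_def bij_betw_same_card)
  also have "\<dots> = (\<Sum>j=1..k. card (?D j))"
    by (rule card_SigmaI) auto
  finally show ?thesis
    by (simp add: des_def)
qed

section \<open>Factorization over the runs\<close>

lemma monom_sum:
  "finite A \<Longrightarrow> monom 1 (\<Sum>j\<in>A. c j) = (\<Prod>j\<in>A. monom (1::'a::comm_semiring_1) (c j))"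
  by (induction A rule: finite_induct) (simp_all, metis mult_1 mult_monom)

text \<open>The runs partition \<open>{1..n}\<close>, so their lengths add up to \<open>n\<close>
  and \<open>sum_bijections_UN\<close> applies with the runs as blocks;
  \<open>sum_bijections_des\<close> evaluates each block to an Eulerian polynomial.\<close>

lemma kstep_poly_eq_prod:
  assumes "1 \<le> k" "k \<le> n" and l: "\<And>j. j \<in> {1..k} \<Longrightarrow> l j = (n - j) div k + 1"
  shows "kstep_poly n k =
    (\<Prod>j=1..k. of_nat ((\<Sum>i=j..k. l i) choose l j) * eulerian_poly (l j))"
    and "(\<Sum>j=1..k. l j) = n"
proof -
  have e: "bij_betw (run_pos k j) {1..l j} (run n k j)" if "j \<in> {1..k}" for j
    using bij_betw_run_pos[OF that assms(2)] l[OF that] by simp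
  have card: "card (run n k j) = l j" if "j \<in> {1..k}" for j
    using bij_betw_same_card[OF e[OF that]] by simp
  have empty: "run n k j = {}" if "j \<notin> {1..k}" for j
    using that assms(1) by (auto simp: run_def Suc_le_eq)
  have disj: "run n k i \<inter> run n k j = {}" if "i \<noteq> j" for i j
    using that by (auto simp: run_def)
  have fin: "finite (run n k j)" for j
    by (simp add: run_def)
  have Un: "(\<Union>j\<in>{1..k}. run n k j) = {1..n}"
    using assms by (intro Un_runs) simp
  have "(\<Sum>j=1..k. card (run n k j)) = card (\<Union>j\<in>{1..k}. run n k j)"
    using fin disj by (intro card_UN_disjoint[symmetric]) auto
  then have sum_card: "(\<Sum>j=1..k. card (run n k j)) = n"
    by (simp only: Un card_atLeastAtMost diff_Suc_1)
  then show "(\<Sum>j=1..k. l j) = n"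
    using card by (simp cong: sum.cong_simp)
  \<comment> \<open>The runs with index outside \<open>{1..k}\<close> are empty, which forces weight 1 on them.\<close>
  let ?w = "\<lambda>j f. if j \<in> {1..k} then monom 1 (des (l j) (\<lambda>i. f (run_pos k j i))) else (1 :: int poly)"
  let ?a = "\<lambda>j. if j \<in> {1..k} then eulerian_poly (l j) else 1"
  have "kstep_poly n k = (\<Sum>p | p permutes {1..n}. \<Prod>j=1..k. ?w j p)"
    unfolding kstep_poly_def
    by (intro sum.cong[OF refl])
      (simp only: inv_kstep_eq_sum_des[OF assms(1,2)] monom_sum finite_atLeastAtMost l
        if_True cong: prod.cong)
  \<comment> \<open>Permutations and extensional bijections of \<open>{1..n}\<close> differ only in
    their values outside \<open>{1..n}\<close>, which the weights never read. Both enumerations are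
    the identity.\<close>
  also have "\<dots> = (\<Sum>f\<in>bijections {1..n} {1..n}. \<Prod>j=1..k. ?w j f)"
  proof (rule sum_permutes_eq_sum_bijections[symmetric])
    show "bij_betw id {1..n} {1..n}" "bij_betw id {1..n} {1..n}"
      by simp_all
    fix p f :: "nat \<Rightarrow> nat" assume pf: "\<And>i. i \<in> {1..n} \<Longrightarrow> f (id i) = id (p i)"
    have "f (run_pos k j i) = p (run_pos k j i)" if "j \<in> {1..k}" "i \<in> {1..l j}" for i j
      using pf bij_betwE[OF e[OF that(1)]] that(2) by (auto simp: run_def)
    then have "des (l j) (\<lambda>i. f (run_pos k j i)) = des (l j) (\<lambda>i. p (run_pos k j i))"
      if "j \<in> {1..k}" for j
      using that unfolding des_def by (intro arg_cong[where f = card]) auto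
    then show "(\<Prod>j=1..k. ?w j f) = (\<Prod>j=1..k. ?w j p)"
      by (intro prod.cong refl) simp
  qed
  also have "\<dots> = (\<Sum>f\<in>bijections (\<Union>j\<in>{1..k}. run n k j) {1..n}. \<Prod>j=1..k. ?w j f)"
    by (simp only: Un)
  also have "\<dots> = (\<Prod>j=1..k.
      of_nat ((\<Sum>i=j..k. card (run n k i)) choose card (run n k j)) * ?a j)"
  proof (rule sum_bijections_UN)
    fix j and f f' :: "nat \<Rightarrow> nat"
    assume ff': "\<And>x. x \<in> run n k j \<Longrightarrow> f x = f' x"
    have "f (run_pos k j i) = f' (run_pos k j i)" if "j \<in> {1..k}" "i \<in> {1..l j}" for i
      using ff' bij_betwE[OF e[OF that(1)]] that(2) by auto
    then show "?w j f = ?w j f'"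
      unfolding des_def by (auto intro!: arg_cong[where f = card] arg_cong[where f = "monom 1"])
  next
    fix j and W :: "nat set" assume W: "finite W" "card W = card (run n k j)"
    show "(\<Sum>f\<in>bijections (run n k j) W. ?w j f) = ?a j"
    proof (cases "j \<in> {1..k}")
      case True
      then show ?thesis
        using sum_bijections_des[OF e[OF True] W(1)] W(2) card by simp
    next
      case False
      then have "W = {}"
        using W by (simp add: empty)
      then have "bijections (run n k j) W = {\<lambda>x::nat. undefined :: nat}"
        by (auto simp: bijections_def bij_betw_def empty[OF False])
      then show ?thesis
        using False by auto
    qed
  qed (use fin disj sum_card in auto)
  also have "\<dots> = (\<Prod>j=1..k. of_nat ((\<Sum>i=j..k. l i) choose l j) * eulerian_poly (l j))"
  proof (rule prod.cong[OF refl])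
    fix j assume j: "j \<in> {1..k}"
    then have "(\<Sum>i=j..k. card (run n k i)) = (\<Sum>i=j..k. l i)"
      by (intro sum.cong refl card) auto
    then show "of_nat ((\<Sum>i=j..k. card (run n k i)) choose card (run n k j)) * ?a j =
      of_nat ((\<Sum>i=j..k. l i) choose l j) * eulerian_poly (l j)"
      by (simp only: card[OF j] j if_True)
  qed
  finally show "kstep_poly n k =
    (\<Prod>j=1..k. of_nat ((\<Sum>i=j..k. l i) choose l j) * eulerian_poly (l j))" .
qed

section \<open>Run lengths and the closed form\<close>

text \<open>Write \<open>n = q * k + t\<close>. If \<open>j \<le> t\<close>, then
  \<open>n - j\<close> is \<open>q * k\<close> plus the remainder \<open>t - j\<close>; otherwise
  one multiple of \<open>k\<close> is borrowed and the remainder is \<open>k + t - j\<close>.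
  Borrowing is possible because \<open>k \<le> n\<close> gives \<open>q > 0\<close>.\<close>

lemma run_length_eq:
  fixes j k n :: nat
  assumes "j \<in> {1..k}" "k \<le> n"
  shows "(n - j) div k + 1 = (if j \<le> n mod k then n div k + 1 else n div k)"
proof -
  define q where "q = n div k"
  define t where "t = n mod k"
  have n: "n = q * k + t" and t: "t < k"
    using assms by (auto simp: q_def t_def)
  have "q > 0"
    using assms by (auto simp: q_def div_greater_zero_iff)
  then obtain q' where q': "q = Suc q'"
    using gr0_implies_Suc by blast
  have "(n - j) div k = (if j \<le> t then q else q')"
  proof (cases "j \<le> t")
    case True
    with t show ?thesis
      by (auto simp: n algebra_simps intro!: div_nat_eqI)
  next
    case False
    with assms show ?thesis
      by (auto simp: n q' algebra_simps intro!: div_nat_eqI)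
  qed
  then show ?thesis
    using q' by (simp add: q_def t_def)
qed

theorem theorem4p4:
  fixes n k s t :: nat and lam :: "nat \<Rightarrow> nat"
  assumes "1 \<le> k" and "k \<le> n"
    and "s = n div k + 1" and "t = n mod k"
    and "lam 0 = 0"
    and "\<And>j. 1 \<le> j \<Longrightarrow> j \<le> k \<Longrightarrow> lam j = (n - j) div k + 1"
  shows "kstep_poly n k =
           of_nat (kstep_count n k 0) * eulerian_poly s ^ t * eulerian_poly (s - 1) ^ (k - t) \<and>
         kstep_count n k 0 = (\<Prod>j = 1..k - 1. (n - (\<Sum>i = 0..j - 1. lam i)) choose lam j)"
proof -
  have lam: "\<And>j. j \<in> {1..k} \<Longrightarrow> lam j = (n - j) div k + 1"
    using assms(6) by simp
  have t: "t < k"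
    using assms by simp
  note sum_lam = kstep_poly_eq_prod(2)[of k n lam, OF assms(1,2) lam]
  have lam_eq: "lam j = (if j \<le> t then s else s - 1)" if "j \<in> {1..k}" for j
    using lam[OF that] run_length_eq[OF that assms(2)] assms(3,4) by simp
  \<comment> \<open>The number of ways to distribute the values among the runs, still including the
    last factor \<open>j = k\<close>.\<close>
  let ?c = "\<Prod>j=1..k. (\<Sum>i=j..k. lam i) choose lam j"
  let ?A = "eulerian_poly s ^ t * eulerian_poly (s - 1) ^ (k - t)"
  have split: "{1..k} = {1..t} \<union> {t+1..k}"
    using t by auto
  have "(\<Prod>j=1..k. eulerian_poly (lam j)) =
    (\<Prod>j=1..t. eulerian_poly (lam j)) * (\<Prod>j=t+1..k. eulerian_poly (lam j))"
    unfolding split by (rule prod.union_disjoint) auto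
  also have "(\<Prod>j=1..t. eulerian_poly (lam j)) = (\<Prod>j=1..t. eulerian_poly s)"
    using t by (intro prod.cong refl) (simp add: lam_eq)
  also have "(\<Prod>j=t+1..k. eulerian_poly (lam j)) = (\<Prod>j=t+1..k. eulerian_poly (s - 1))"
    using t by (intro prod.cong refl) (simp add: lam_eq)
  finally have A: "(\<Prod>j=1..k. eulerian_poly (lam j)) = ?A"
    by simp
  have poly: "kstep_poly n k = of_nat ?c * ?A"
    using kstep_poly_eq_prod(1)[of k n lam, OF assms(1,2) lam] by (simp only: prod.distrib A of_nat_prod)
  \<comment> \<open>Compare constant coefficients: every Eulerian polynomial has constant term 1,
    hence so does \<open>?A\<close>, and \<open>?c\<close> alone remains.\<close>
  have "int (kstep_count n k 0) = int ?c"
    unfolding coeff_kstep_poly[symmetric] poly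
    by (simp add: coeff_mult_0 coeff_0_power coeff_0_eulerian_poly of_nat_poly del: of_nat_prod)
  then have count: "kstep_count n k 0 = ?c"
    by (simp only: of_nat_eq_iff)
  have tail: "(\<Sum>i=j..k. lam i) = n - (\<Sum>i=0..j - 1. lam i)" if "j \<in> {1..k}" for j
  proof -
    have "{1..k} = {1..j - 1} \<union> {j..k}"
      using that by auto
    moreover have "sum lam ({1..j - 1} \<union> {j..k}) = (\<Sum>i=1..j - 1. lam i) + (\<Sum>i=j..k. lam i)"
      by (rule sum.union_disjoint) auto
    ultimately have "n = (\<Sum>i=1..j - 1. lam i) + (\<Sum>i=j..k. lam i)"
      using sum_lam by simp
    moreover have "(\<Sum>i=0..j - 1. lam i) = (\<Sum>i=1..j - 1. lam i)"
      using assms(5) by (simp add: sum.atLeast_Suc_atMost)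
    ultimately show ?thesis
      by simp
  qed
  \<comment> \<open>The factor for \<open>j = k\<close> is \<open>lam k choose lam k\<close>, which
    is 1: the last run takes all remaining values.\<close>
  have "?c = (\<Prod>j=1..k - 1. (\<Sum>i=j..k. lam i) choose lam j)"
    using assms(1) by (cases k) auto
  also have "\<dots> = (\<Prod>j=1..k - 1. (n - (\<Sum>i=0..j - 1. lam i)) choose lam j)"
    by (intro prod.cong refl) (subst tail, auto)
  finally show ?thesis
    using poly count by (simp add: mult.assoc)
qed

end
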